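(* Let $(X_1,x_1)$ and $(X_2,x_2)$ be LMPs and $R\subseteq UX_1\times UX_2$ a binary relation. The following are equivalent: (1) $R$ is a bisimulation relation between $(X_1,x_1)$ and $(X_2,x_2)$; (2) $(x_1,x_2)$ is a morphism of type $(R,X_1,X_2)\to\mathrm{Act}\pitchfork\dot G(R,X_1,X_2)$ in $\mathbf{BRel}(\mathbf{Meas})$, where $\dot G$ is the codensity lifting of $\mathcal G^2$ along $q$ with single lifting parameter $(1,1)$ and $S=({=},G1,G1)$.
   Context: $\mathbf{Meas}$: measurable spaces, $U$ forgetful, $\Sigma_X$ the $\sigma$-algebra. Sub-Giry monad $\mathcal G$: $GX$ is the set of subprobability measures on $X$ with $\sigma$-algebra generated by $\{\mu\mid\mu(V)\in W\}$ ($V\in\Sigma_X$, $W$ open in $[0,1]$); $G1$ is the Borel space of $[0,1]$; ${=}$ is equality on $[0,1]$. Fix a set $\mathrm{Act}$. An LMP is $(X,x)$ with $x:X\to\mathrm{Act}\pitchfork GX$ measurable (product in $\mathbf{Meas}$, projections $\pi_a$). For $P\subseteq I\times J$, $(V,W)$ is $P$-closed if $\forall(x,y)\in P.\ x\in V\iff y\in W$. $R$ is a bisimulation relation between $(X_1,x_1)$ and $(X_2,x_2)$ if for all $(s_1,s_2)\in R$, $a\in\mathrm{Act}$, $V\in\Sigma_{X_1}$, $W\in\Sigma_{X_2}$: $(V,W)$ $R$-closed implies $\pi_a(x_1(s_1))(V)=\pi_a(x_2(s_2))(W)$. $\mathbf{BRel}(\mathbf{Meas})$: objects $(Y_0,Y_1,Y_2)$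 with $Y_0\subseteq UY_1\times UY_2$; morphisms pairs of measurable maps $(f_1,f_2)$ with $(f_1\times f_2)(Y_0)\subseteq Y'_0$; $q(Y)=(Y_1,Y_2)$. The power $\mathrm{Act}\pitchfork(Y_0,Y_1,Y_2)$ is $(\{(f,g)\mid\forall a.(\pi_af,\pi_ag)\in Y_0\},\mathrm{Act}\pitchfork Y_1,\mathrm{Act}\pitchfork Y_2)$. The codensity lifting $\dot G$ (lifting $\mathcal G\times\mathcal G$) has $\dot GY=((\dot GY)_0,GY_1,GY_2)$, $(\dot GY)_0=\{(v_1,v_2)\mid\forall(f,g)\in\mathbf{BRel}(\mathbf{Meas})(Y,S).\ \int f\,dv_1=\int g\,dv_2\}$. *)

theory Defs
  imports "HOL-Probability.Giry_Monad"
begin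

text \<open>
  A measurable space is represented by a value of type \<open>'a measure\<close>, of which only \<open>space\<close> and
  \<open>sets\<close> matter. The sub-Giry space \<open>G X\<close> is \<open>subprob_algebra X\<close>, and the power of a measurable
  space by the set \<open>Act\<close> is \<open>\<Pi>\<^sub>M a\<in>Act. X\<close>, with \<open>a\<close>-th projection \<open>\<lambda>h. h a\<close>.

  Pitfall: the library requires subprobability spaces to be non-empty, so \<open>subprob_algebra X\<close> is
  empty rather than a singleton (the zero measure) if \<open>space X = {}\<close>. Functions out of the empty
  space are vacuously measurable in either case, so this does not affect which LMPs exist, nor the
  relations on them.
\<close>

definition lmp :: "'act set \<Rightarrow> 'a measure \<Rightarrow> ('a \<Rightarrow> 'act \<Rightarrow> 'a measure) \<Rightarrow> bool" where
  "lmp Act X x \<longleftrightarrow> x \<in> X \<rightarrow>\<^sub>M (\<Pi>\<^sub>M a\<in>Act. subprob_algebra X)"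

definition rel_closed :: "('a \<times> 'b) set \<Rightarrow> 'a set \<Rightarrow> 'b set \<Rightarrow> bool" where
  "rel_closed P V W \<longleftrightarrow> (\<forall>(x, y)\<in>P. x \<in> V \<longleftrightarrow> y \<in> W)"

definition bisimulation_relation ::
    "'act set \<Rightarrow> 'a measure \<Rightarrow> ('a \<Rightarrow> 'act \<Rightarrow> 'a measure) \<Rightarrow>
      'b measure \<Rightarrow> ('b \<Rightarrow> 'act \<Rightarrow> 'b measure) \<Rightarrow> ('a \<times> 'b) set \<Rightarrow> bool" where
  "bisimulation_relation Act X1 x1 X2 x2 R \<longleftrightarrow>
    (\<forall>(s1, s2)\<in>R. \<forall>a\<in>Act. \<forall>V\<in>sets X1. \<forall>W\<in>sets X2.
      rel_closed R V W \<longrightarrow> emeasure (x1 s1 a) V = emeasure (x2 s2 a) W)"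

text \<open>
  Objects of \<open>BRel(Meas)\<close>. The side condition \<open>Y0 \<subseteq> space Y1 \<times> space Y2\<close> is not part of the type;
  it holds by construction for the objects built below.
\<close>

type_synonym ('a, 'b) brel = "('a \<times> 'b) set \<times> 'a measure \<times> 'b measure"

fun brel_hom :: "('a, 'b) brel \<Rightarrow> ('c, 'd) brel \<Rightarrow> (('a \<Rightarrow> 'c) \<times> ('b \<Rightarrow> 'd)) set" where
  "brel_hom (Y0, Y1, Y2) (Z0, Z1, Z2) =
    {(f1, f2). f1 \<in> Y1 \<rightarrow>\<^sub>M Z1 \<and> f2 \<in> Y2 \<rightarrow>\<^sub>M Z2 \<and> map_prod f1 f2 ` Y0 \<subseteq> Z0}"

fun brel_power :: "'act set \<Rightarrow> ('a, 'b) brel \<Rightarrow> ('act \<Rightarrow> 'a, 'act \<Rightarrow> 'b) brel" where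
  "brel_power Act (Y0, Y1, Y2) =
    ({(f, g) \<in> space (\<Pi>\<^sub>M a\<in>Act. Y1) \<times> space (\<Pi>\<^sub>M a\<in>Act. Y2). \<forall>a\<in>Act. (f a, g a) \<in> Y0},
     \<Pi>\<^sub>M a\<in>Act. Y1, \<Pi>\<^sub>M a\<in>Act. Y2)"

text \<open>
  The lifting parameter \<open>S = (=, G 1, G 1)\<close>: a subprobability measure on the one-point space is
  identified with its total mass, so that \<open>G 1\<close> is the Borel space of \<open>[0,1]\<close>.
\<close>

definition G1 :: "real measure" where
  "G1 = restrict_space borel {0..1}"

definition lifting_param :: "(real, real) brel" where
  "lifting_param = (Id_on {0..1}, G1, G1)"

text \<open>
  The codensity lifting along \<open>q\<close>. For \<open>f : Y1 \<rightarrow> G 1\<close>, the Kleisli extension \<open>G Y1 \<rightarrow> G 1\<close> of \<open>f\<close>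
  sends \<open>v\<close> to the integral of \<open>f\<close> with respect to \<open>v\<close>; the integrand is bounded and \<open>v\<close> is finite,
  so the Bochner integral below is a genuine one.
\<close>

fun codensity_lifting :: "('a, 'b) brel \<Rightarrow> ('a measure, 'b measure) brel" where
  "codensity_lifting (Y0, Y1, Y2) =
    ({(v1, v2) \<in> space (subprob_algebra Y1) \<times> space (subprob_algebra Y2).
        \<forall>(f, g)\<in>brel_hom (Y0, Y1, Y2) lifting_param.
          integral\<^sup>L v1 f = integral\<^sup>L v2 g},
     subprob_algebra Y1, subprob_algebra Y2)"

end

theory Submission
  imports Defs
begin

text \<open>
  A morphism \<open>(f, g)\<close> to the lifting parameter pulls every Borel set back to a closed pair, so if two
  measures agree on closed pairs, then the push-forwards along \<open>f\<close> and \<open>g\<close> are the same measure on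
  the real line, and the integrals of \<open>f\<close> and \<open>g\<close> are both its mean. Conversely, the
  indicators of a closed pair form such a morphism.
\<close>

text \<open>The bound on \<open>f x\<close> reappears for pairs in \<open>R\<close> because
  \<open>R\<close> is not assumed here to lie in the product of the two spaces.\<close>

lemma brel_hom_lifting_param_iff:
  "(f, g) \<in> brel_hom (R, X1, X2) lifting_param \<longleftrightarrow>
    f \<in> borel_measurable X1 \<and> f \<in> space X1 \<rightarrow> {0..1} \<and>
    g \<in> borel_measurable X2 \<and> g \<in> space X2 \<rightarrow> {0..1} \<and>
    (\<forall>(x, y)\<in>R. f x = g y \<and> f x \<in> {0..1})"
  by (simp add: lifting_param_def G1_def measurable_restrict_space2_iff image_subset_iff
      Id_on_iff map_prod_def split_beta conj_ac)

lemma brel_hom_indicators: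
  assumes "V \<in> sets X1" "W \<in> sets X2" "rel_closed R V W"
  shows "(indicator V, indicator W) \<in> brel_hom (R, X1, X2) lifting_param"
  using assms by (auto simp: brel_hom_lifting_param_iff rel_closed_def indicator_def)

text \<open>For related \<open>x\<close> and \<open>y\<close>, both memberships ask whether the
  common value \<open>f x = g y\<close> lies in \<open>B\<close>. The inclusion of \<open>R\<close>
  in the product makes the intersections with the spaces harmless.\<close>

lemma rel_closed_vimage:
  assumes "R \<subseteq> space X1 \<times> space X2" "\<forall>(x, y)\<in>R. f x = g y"
  shows "rel_closed R (f -` B \<inter> space X1) (g -` B \<inter> space X2)"
  using assms by (fastforce simp: rel_closed_def)

text \<open>This is the equivalence for a single pair of measures; the theorem applies it at each
  related pair of states and each action.\<close>

lemma codensity_lifting_iff: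
  assumes R: "R \<subseteq> space X1 \<times> space X2"
    and v1: "v1 \<in> space (subprob_algebra X1)" and v2: "v2 \<in> space (subprob_algebra X2)"
  shows "(v1, v2) \<in> fst (codensity_lifting (R, X1, X2)) \<longleftrightarrow>
    (\<forall>V\<in>sets X1. \<forall>W\<in>sets X2. rel_closed R V W \<longrightarrow> emeasure v1 V = emeasure v2 W)"
    (is "?L \<longleftrightarrow> ?R")
proof -
  have sets1: "sets v1 = sets X1" and sets2: "sets v2 = sets X2"
    using v1 v2 by (auto simp: space_subprob_algebra)
  have sp1: "space v1 = space X1" and sp2: "space v2 = space X2"
    using sets_eq_imp_space_eq[OF sets1] sets_eq_imp_space_eq[OF sets2] by auto
  interpret v1: subprob_space v1 using v1 by (simp add: space_subprob_algebra)
  interpret v2: subprob_space v2 using v2 by (simp add: space_subprob_algebra)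
  show ?thesis
  proof
    assume L: ?L
    show ?R
    proof (intro ballI impI)
      fix V W assume VW: "V \<in> sets X1" "W \<in> sets X2" "rel_closed R V W"
      have "integral\<^sup>L v1 (indicator V :: _ \<Rightarrow> real) = integral\<^sup>L v2 (indicator W)"
        using L brel_hom_indicators[OF VW] by auto
      \<comment> \<open>The integral of an indicator is the measure of the set intersected with the
        whole space.\<close>
      moreover have "V \<inter> space X1 = V" "W \<inter> space X2 = W"
        using VW(1,2) by simp_all
      ultimately have "measure v1 V = measure v2 W"
        by (simp add: sp1 sp2)
      then show "emeasure v1 V = emeasure v2 W"
        by (simp add: v1.emeasure_eq_measure v2.emeasure_eq_measure)
    qed
  next
    assume A: ?R
    have "integral\<^sup>L v1 f = integral\<^sup>L v2 g"
      if fg: "(f, g) \<in> brel_hom (R, X1, X2) lifting_param" for f g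
    proof -
      have fX: "f \<in> borel_measurable X1" and gX: "g \<in> borel_measurable X2"
        and eq: "\<forall>(x, y)\<in>R. f x = g y"
        using fg by (auto simp: brel_hom_lifting_param_iff)
      have f: "f \<in> borel_measurable v1" and g: "g \<in> borel_measurable v2"
        using fX gX by (simp_all cong: measurable_cong_sets add: sets1 sets2)
      \<comment> \<open>Every Borel set \<open>B\<close> can be tested directly, without a
        generating family: its two preimages form a closed pair, to which the assumption
        applies.\<close>
      have "distr v1 borel f = distr v2 borel g"
      proof (rule measure_eqI)
        fix B assume "B \<in> sets (distr v1 borel f)"
        then have B: "B \<in> sets borel" by simp
        have "emeasure v1 (f -` B \<inter> space X1) = emeasure v2 (g -` B \<inter> space X2)"
          using A rel_closed_vimage[OF R eq] measurable_sets[OF fX B] measurable_sets[OF gX B]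
          by blast
        then show "emeasure (distr v1 borel f) B = emeasure (distr v2 borel g) B"
          by (simp add: emeasure_distr f g B sp1 sp2)
      qed simp
      \<comment> \<open>By change of variables, integrating the identity against the push-forwards
        gives the integrals of \<open>f\<close> and \<open>g\<close>.\<close>
      then have "integral\<^sup>L (distr v1 borel f) (\<lambda>r. r) = integral\<^sup>L (distr v2 borel g) (\<lambda>r. r)"
        by simp
      then show ?thesis
        by (simp add: integral_distr f g)
    qed
    then show ?L
      using v1 v2 by auto
  qed
qed

theorem theorem4p12:
  fixes Act :: "'act set"
    and X1 :: "'a measure" and x1 :: "'a \<Rightarrow> 'act \<Rightarrow> 'a measure"
    and X2 :: "'b measure" and x2 :: "'b \<Rightarrow> 'act \<Rightarrow> 'b measure"
    and R :: "('a \<times> 'b) set"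
  assumes "lmp Act X1 x1" and "lmp Act X2 x2"
    and "R \<subseteq> space X1 \<times> space X2"
  shows "bisimulation_relation Act X1 x1 X2 x2 R \<longleftrightarrow>
    (x1, x2) \<in> brel_hom (R, X1, X2) (brel_power Act (codensity_lifting (R, X1, X2)))"
proof -
  have x1: "x1 \<in> X1 \<rightarrow>\<^sub>M (\<Pi>\<^sub>M a\<in>Act. subprob_algebra X1)"
    and x2: "x2 \<in> X2 \<rightarrow>\<^sub>M (\<Pi>\<^sub>M a\<in>Act. subprob_algebra X2)"
    using assms(1,2) by (simp_all add: lmp_def)
  \<comment> \<open>The relation of the power also demands membership in the product spaces, which
    measurability supplies at related states.\<close>
  have pow: "x1 (fst p) \<in> space (\<Pi>\<^sub>M a\<in>Act. subprob_algebra X1)"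
      "x2 (snd p) \<in> space (\<Pi>\<^sub>M a\<in>Act. subprob_algebra X2)" if "p \<in> R" for p
  proof -
    have "fst p \<in> space X1" "snd p \<in> space X2"
      using that assms(3) by (auto simp: mem_Times_iff)
    then show "x1 (fst p) \<in> space (\<Pi>\<^sub>M a\<in>Act. subprob_algebra X1)"
        "x2 (snd p) \<in> space (\<Pi>\<^sub>M a\<in>Act. subprob_algebra X2)"
      using measurable_space[OF x1] measurable_space[OF x2] by blast+
  qed
  \<comment> \<open>Naming the relation part lets the power and the morphisms be unfolded while the
    lifting itself stays opaque.\<close>
  obtain C where C: "codensity_lifting (R, X1, X2) = (C, subprob_algebra X1, subprob_algebra X2)"
    by simp
  have "(x1, x2) \<in> brel_hom (R, X1, X2) (brel_power Act (codensity_lifting (R, X1, X2))) \<longleftrightarrow>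
      (\<forall>(s1, s2)\<in>R. \<forall>a\<in>Act. (x1 s1 a, x2 s2 a) \<in> C)"
    unfolding C brel_power.simps brel_hom.simps image_subset_iff
    using x1 x2 pow by (simp add: split_beta)
  also have "\<dots> \<longleftrightarrow> bisimulation_relation Act X1 x1 X2 x2 R"
    unfolding bisimulation_relation_def
  proof (intro ball_cong refl, clarify, intro ball_cong refl)
    fix t1 t2 a assume "(t1, t2) \<in> R" "a \<in> Act"
    then have "x1 t1 a \<in> space (subprob_algebra X1)" "x2 t2 a \<in> space (subprob_algebra X2)"
      using pow[of "(t1, t2)"] by (auto simp: space_PiM PiE_iff)
    then show "(x1 t1 a, x2 t2 a) \<in> C \<longleftrightarrow>
        (\<forall>V\<in>sets X1. \<forall>W\<in>sets X2. rel_closed R V W \<longrightarrow>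
          emeasure (x1 t1 a) V = emeasure (x2 t2 a) W)"
      by (rule codensity_lifting_iff[OF assms(3), unfolded C fst_conv])
  qed
  finally show ?thesis by simp
qed

end
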